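(* For $\beta_2\in\mathbb R$ let $$\psi_\wedge(\beta_2)=\sup_W\Big\{\beta_2\,t_{\mathrm{ind}}(K_{1,2},W)-\tfrac12\mathcal I(W)\Big\},\qquad \psi^{\mathrm{const}}_\wedge(\beta_2)=\sup_{c\in[0,1]}\Big\{\beta_2c^2(1-c)-\tfrac12I(c)\Big\},$$ where the first supremum is over all graphons $W$ and $I(c)=c\log c+(1-c)\log(1-c)$. Then: (1) for $|\beta_2|<\frac13$, $\psi_\wedge(\beta_2)=\psi^{\mathrm{const}}_\wedge(\beta_2)$; (2) for $\beta_2\ge3.054$, $\psi_\wedge(\beta_2)>\psi^{\mathrm{const}}_\wedge(\beta_2)$.
   Context: A graphon is a measurable symmetric function $W:[0,1]^2\to[0,1]$. $t_{\mathrm{ind}}(K_{1,2},W)=\int_{[0,1]^3}W(x,y)W(x,z)(1-W(y,z))\,dx\,dy\,dz$ and $\mathcal I(W)=\int_{[0,1]^2}I(W(x,y))\,dx\,dy$, with $0\log0=0$. $\psi^{\mathrm{const}}_\wedge(\beta_2)$ is the value of the variational problem restricted to constant graphons $W\equiv c$. *)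

theory Defs
  imports "HOL-Analysis.Analysis"
begin

text \<open>
  Graphons are curried functions of which only the values on the unit square matter;
  measurability is Lebesgue measurability on that square.
\<close>

definition graphon :: "(real \<Rightarrow> real \<Rightarrow> real) \<Rightarrow> bool" where
  "graphon W \<longleftrightarrow>
     (\<lambda>(x, y). W x y) \<in> borel_measurable (lebesgue_on ({0..1} \<times> {0..1})) \<and>
     (\<forall>x\<in>{0..1}. \<forall>y\<in>{0..1}. W x y = W y x) \<and>
     (\<forall>x\<in>{0..1}. \<forall>y\<in>{0..1}. W x y \<in> {0..1})"

text \<open>
  The convention \<open>0 log 0 = 0\<close> is automatic, since multiplication by \<open>0\<close> gives \<open>0\<close>.
\<close>

definition entropy_I :: "real \<Rightarrow> real" where
  "entropy_I c = c * ln c + (1 - c) * ln (1 - c)"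

definition graphon_I :: "(real \<Rightarrow> real \<Rightarrow> real) \<Rightarrow> real" where
  "graphon_I W = (LINT (x, y)|lebesgue_on ({0..1} \<times> {0..1}). entropy_I (W x y))"

definition t_ind_K12 :: "(real \<Rightarrow> real \<Rightarrow> real) \<Rightarrow> real" where
  "t_ind_K12 W = (LINT (x, y, z)|lebesgue_on ({0..1} \<times> {0..1} \<times> {0..1}).
     W x y * W x z * (1 - W y z))"

text \<open>
  Both suprema below are over nonempty sets that are bounded above by
  \<open>\<bar>\<beta>\<^sub>2\<bar> + ln 2 / 2\<close>, so the real-valued \<open>Sup\<close> is the genuine supremum.
\<close>

definition psi_wedge :: "real \<Rightarrow> real" where
  "psi_wedge \<beta>\<^sub>2 = (SUP W\<in>{W. graphon W}. \<beta>\<^sub>2 * t_ind_K12 W - graphon_I W / 2)"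

definition psi_wedge_const :: "real \<Rightarrow> real" where
  "psi_wedge_const \<beta>\<^sub>2 = (SUP c\<in>{0..1}. \<beta>\<^sub>2 * c\<^sup>2 * (1 - c) - entropy_I c / 2)"

end

theory Submission
  imports Defs "HOL-Probability.Probability_Measure"
begin

text \<open>
  Write a graphon of mean \<open>c\<close> as \<open>W = c + U\<close>. Since \<open>\<integral>U = 0\<close>, the induced density changes from
  \<open>c\<^sup>2 (1 - c)\<close> only by terms of order two and three in \<open>U\<close>, which AM-GM bounds by \<open>3 \<integral>U\<^sup>2\<close>, while
  strong convexity of \<open>I\<close> (\<open>I'' \<ge> 4\<close>) raises the entropy integral by at least \<open>2 \<integral>U\<^sup>2\<close>. So for
  \<open>\<bar>\<beta>\<^sub>2\<bar> \<le> 1/3\<close> the constant graphon \<open>c\<close> does at least as well as \<open>W\<close>.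

  For \<open>\<beta>\<^sub>2 \<ge> 3.054\<close> the constants are beaten by the graphon with two blocks of measure \<open>1/2\<close>, value
  \<open>1/15\<close> inside the blocks and \<open>224/225\<close> across. At \<open>\<beta>\<^sub>2 = 3.054\<close> this is a numerical comparison
  (about \<open>0.77826\<close> against \<open>0.77816\<close>), and it persists for larger \<open>\<beta>\<^sub>2\<close> because the induced density of
  the two-block graphon exceeds \<open>4/27 = max c\<^sup>2 (1 - c)\<close>.
\<close>

section \<open>Completion, restriction and products of Lebesgue measure\<close>

text \<open>A map that preserves measure pulls null sets back to null sets, so measurability
  survives enlarging both sigma-algebras by null sets. This lifts the projections below from Borel
  products to Lebesgue measure.\<close>

lemma completion_measure_preserving:
  assumes f: "f \<in> M \<rightarrow>\<^sub>M N" and eq: "distr M N f = N"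
  shows "f \<in> completion M \<rightarrow>\<^sub>M completion N"
    and "distr (completion M) (completion N) f = completion N"
proof -
  have f': "f \<in> completion M \<rightarrow>\<^sub>M N" using f by (rule measurable_completion)
  have d: "distr (completion M) N f = N" using distr_completion[OF f] eq by simp
  show "f \<in> completion M \<rightarrow>\<^sub>M completion N"
    using completion.measurable_completion2[OF f'] d by simp
  show "distr (completion M) (completion N) f = completion N"
    using completion.completion_distr_eq[OF f'] d by simp
qed

text \<open>A Lebesgue set inside \<open>S\<close> is a Borel set plus a piece of a Borel null set,
  and cutting that null set down to \<open>S\<close> keeps the decomposition inside
  \<open>S\<close>. Hence restricting and completing commute, and facts about uncompleted products
  reach \<open>lebesgue_on\<close>.\<close>

lemma lebesgue_on_eq_completion:
  assumes "S \<in> sets borel"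
  shows "lebesgue_on S = completion (restrict_space lborel S)"
proof (rule measure_eqI)
  have null: "null_sets (restrict_space lborel S) = {N \<in> null_sets lborel. N \<subseteq> S}"
    using assms by (auto simp: null_sets_restrict_space)
  show "sets (lebesgue_on S) = sets (completion (restrict_space lborel S))"
  proof (intro equalityI subsetI)
    fix A assume "A \<in> sets (lebesgue_on S)"
    then have A: "A \<in> sets lebesgue" "A \<subseteq> S"
      using assms by (auto simp: sets_restrict_space_iff)
    from A(1) obtain B N N' where B: "A = B \<union> N" "N \<subseteq> N'" "N' \<in> null_sets lborel" "B \<in> sets lborel"
      by (rule sets_completionE)
    show "A \<in> sets (completion (restrict_space lborel S))"
      using B A(2) assms null
      by (intro sets_completionI[of A B N "N' \<inter> S"])
         (auto simp: sets_restrict_space_iff null_set_Int2 null_set_Int1)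
  next
    fix A assume "A \<in> sets (completion (restrict_space lborel S))"
    then obtain B N N' where B: "A = B \<union> N" "N \<subseteq> N'" "N' \<in> null_sets (restrict_space lborel S)"
        "B \<in> sets (restrict_space lborel S)"
      by (rule sets_completionE)
    have "B \<in> sets lborel" "B \<subseteq> S" "N' \<in> null_sets lborel" "N' \<subseteq> S"
      using B(3,4) assms null by (auto simp: sets_restrict_space_iff)
    then have "A \<in> sets lebesgue" "A \<subseteq> S"
      using B(1,2) sets_completionI[OF B(1,2)] by blast+
    then show "A \<in> sets (lebesgue_on S)" using assms by (auto simp: sets_restrict_space_iff)
  qed
  fix A assume "A \<in> sets (lebesgue_on S)"
  then have A: "A \<in> sets lebesgue" "A \<subseteq> S"
    using assms by (auto simp: sets_restrict_space_iff)
  from A(1) obtain B N N' where B: "A = B \<union> N" "N \<subseteq> N'" "N' \<in> null_sets lborel" "B \<in> sets lborel"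
    by (rule sets_completionE)
  have N: "N \<in> null_sets (completion lborel)"
    by (rule null_sets_completion_subset[OF B(2) null_sets_completionI[OF B(3)]])
  have N': "N \<in> null_sets (completion (restrict_space lborel S))"
  proof (rule null_sets_completion_subset)
    show "N \<subseteq> N' \<inter> S" using B(1,2) A(2) by blast
    show "N' \<inter> S \<in> null_sets (completion (restrict_space lborel S))"
      using B(3) assms by (intro null_sets_completionI) (auto simp: null intro: null_set_Int1 null_set_Int2)
  qed
  have BS: "B \<in> sets (restrict_space lborel S)"
    using B A(2) assms by (auto simp: sets_restrict_space_iff)
  have "emeasure (lebesgue_on S) A = emeasure lebesgue (B \<union> N)"
    using A(2) assms B(1) by (simp add: emeasure_restrict_space)
  also have "\<dots> = emeasure lborel B"
    using B N by (subst emeasure_Un_null_set) auto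
  also have "\<dots> = emeasure (restrict_space lborel S) B"
    using A(2) assms B(1) by (subst emeasure_restrict_space) auto
  also have "\<dots> = emeasure (completion (restrict_space lborel S)) (B \<union> N)"
    using BS N' by (subst emeasure_Un_null_set) auto
  finally show "emeasure (lebesgue_on S) A = emeasure (completion (restrict_space lborel S)) A"
    using B(1) by simp
qed

lemma prob_space_unit: "prob_space (restrict_space lborel {0..1::real})"
  by (intro prob_spaceI) (simp add: emeasure_restrict_space)

lemma emeasure_lborel_Times:
  fixes A :: "'a::euclidean_space set" and B :: "'b::euclidean_space set"
  assumes "A \<in> sets borel" "B \<in> sets borel"
  shows "emeasure lborel (A \<times> B) = emeasure lborel A * emeasure lborel B"
  using assms unfolding lborel_prod[symmetric] by (intro lborel.emeasure_pair_measure_Times) auto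

lemma restrict_lborel_Times:
  fixes A :: "'a::euclidean_space set" and B :: "'b::euclidean_space set"
  assumes "A \<in> sets borel" "B \<in> sets borel"
  shows "restrict_space lborel A \<Otimes>\<^sub>M restrict_space lborel B = restrict_space lborel (A \<times> B)"
proof (rule pair_measure_eqI)
  show "sigma_finite_measure (restrict_space lborel A)" "sigma_finite_measure (restrict_space lborel B)"
    using assms by (auto intro!: sigma_finite_measure_restrict_space lborel.sigma_finite_measure_axioms)
  show "sets (restrict_space lborel A \<Otimes>\<^sub>M restrict_space lborel B) = sets (restrict_space lborel (A \<times> B))"
    (is "sets ?P = sets ?R")
  proof (intro equalityI)
    show "sets ?P \<subseteq> sets ?R"
      unfolding sets_pair_measure
      using assms by (intro sets.sigma_sets_subset') (auto simp: sets_restrict_space_iff space_restrict_space borel_Times)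
    \<comment> \<open>The identity, written as the pair of projections, is measurable into the Borel
      product; the preimage of a Borel subset of \<open>A \<times> B\<close> is that subset
      itself.\<close>
    have id: "(\<lambda>p. (fst p, snd p)) \<in> ?P \<rightarrow>\<^sub>M (borel \<Otimes>\<^sub>M borel)"
      by (intro measurable_Pair measurable_compose[OF measurable_fst] measurable_compose[OF measurable_snd]
            measurable_restrict_space1) auto
    show "sets ?R \<subseteq> sets ?P"
    proof
      fix X assume "X \<in> sets ?R"
      then have "X \<in> sets borel" and X2: "X \<subseteq> A \<times> B"
        using assms by (auto simp: sets_restrict_space_iff borel_Times)
      then have X: "X \<in> sets (borel \<Otimes>\<^sub>M borel)"
        by (simp only: borel_prod)
      have "(\<lambda>p. (fst p, snd p)) -` X \<inter> space ?P = X"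
        using X2 by (auto simp: space_pair_measure space_restrict_space)
      then show "X \<in> sets ?P" using measurable_sets[OF id X] by simp
    qed
  qed
  fix C D assume "C \<in> sets (restrict_space lborel A)" "D \<in> sets (restrict_space lborel B)"
  then show "emeasure (restrict_space lborel A) C * emeasure (restrict_space lborel B) D =
     emeasure (restrict_space lborel (A \<times> B)) (C \<times> D)"
    using assms by (auto simp: emeasure_restrict_space sets_restrict_space_iff borel_Times
      emeasure_lborel_Times Sigma_mono)
qed

text \<open>Product measures are determined by rectangles. The preimage of a rectangle under a
  projection is a box whose remaining side is the whole space, of measure 1.\<close>

lemma (in prob_space) distr_triple_projections:
  "distr (M \<Otimes>\<^sub>M (M \<Otimes>\<^sub>M M)) (M \<Otimes>\<^sub>M M) (\<lambda>(x, y, z). (x, y)) = M \<Otimes>\<^sub>M M" (is ?f)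
  "distr (M \<Otimes>\<^sub>M (M \<Otimes>\<^sub>M M)) (M \<Otimes>\<^sub>M M) (\<lambda>(x, y, z). (x, z)) = M \<Otimes>\<^sub>M M" (is ?g)
  "distr (M \<Otimes>\<^sub>M (M \<Otimes>\<^sub>M M)) (M \<Otimes>\<^sub>M M) (\<lambda>(x, y, z). (y, z)) = M \<Otimes>\<^sub>M M" (is ?h)
proof -
  have s: "sigma_finite_measure M" ..
  interpret P: pair_prob_space M M ..
  interpret P3: pair_prob_space M "M \<Otimes>\<^sub>M M" ..
  let ?P3 = "M \<Otimes>\<^sub>M (M \<Otimes>\<^sub>M M)"
  have *: "distr ?P3 (M \<Otimes>\<^sub>M M) f = M \<Otimes>\<^sub>M M"
    if [measurable]: "f \<in> ?P3 \<rightarrow>\<^sub>M (M \<Otimes>\<^sub>M M)"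
      and f: "\<And>A B. A \<in> sets M \<Longrightarrow> B \<in> sets M \<Longrightarrow> emeasure ?P3 (f -` (A \<times> B) \<inter> space ?P3) = emeasure M A * emeasure M B"
    for f
    by (rule pair_measure_eqI[OF s s, symmetric]) (simp_all add: emeasure_distr f)
  have box: "emeasure ?P3 X = emeasure M A * (emeasure M B * emeasure M C)"
    if "X = A \<times> B \<times> C" "A \<in> sets M" "B \<in> sets M" "C \<in> sets M" for X A B C
    using that by (simp add: emeasure_pair_measure_Times P.emeasure_pair_measure_Times)
  show ?f
  proof (rule *)
    fix A B assume "A \<in> sets M" "B \<in> sets M"
    then show "emeasure ?P3 ((\<lambda>(x, y, z). (x, y)) -` (A \<times> B) \<inter> space ?P3) = emeasure M A * emeasure M B"
      by (subst box[of _ A B "space M"]) (auto simp: space_pair_measure emeasure_space_1 dest: sets.sets_into_space)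
  qed measurable
  show ?g
  proof (rule *)
    fix A B assume "A \<in> sets M" "B \<in> sets M"
    then show "emeasure ?P3 ((\<lambda>(x, y, z). (x, z)) -` (A \<times> B) \<inter> space ?P3) = emeasure M A * emeasure M B"
      by (subst box[of _ A "space M" B]) (auto simp: space_pair_measure emeasure_space_1 dest: sets.sets_into_space)
  qed measurable
  show ?h
  proof (rule *)
    fix A B assume "A \<in> sets M" "B \<in> sets M"
    then show "emeasure ?P3 ((\<lambda>(x, y, z). (y, z)) -` (A \<times> B) \<inter> space ?P3) = emeasure M A * emeasure M B"
      by (subst box[of _ "space M" A B]) (auto simp: space_pair_measure emeasure_space_1 dest: sets.sets_into_space)
  qed measurable
qed

section \<open>The unit square and cube as probability spaces\<close>

abbreviation unit_square :: "(real \<times> real) measure" where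
  "unit_square \<equiv> lebesgue_on ({0..1} \<times> {0..1})"

abbreviation unit_cube :: "(real \<times> real \<times> real) measure" where
  "unit_cube \<equiv> lebesgue_on ({0..1} \<times> {0..1} \<times> {0..1})"

lemma unit_square_eq: "unit_square = completion (restrict_space lborel {0..1} \<Otimes>\<^sub>M restrict_space lborel {0..1})"
  by (simp add: lebesgue_on_eq_completion restrict_lborel_Times borel_Times)

lemma unit_cube_eq: "unit_cube = completion (restrict_space lborel {0..1} \<Otimes>\<^sub>M
    (restrict_space lborel {0..1} \<Otimes>\<^sub>M restrict_space lborel {0..1}))"
  by (simp add: lebesgue_on_eq_completion restrict_lborel_Times borel_Times)

text \<open>A graphon is only Lebesgue measurable, so composing it with a projection is not
  automatic: preimages of null sets must be null. Preservation of measure gives this, and also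
  reduces cube integrals of a function of one edge to square integrals.\<close>

lemma unit_cube_projections:
  "(\<lambda>(x, y, z). (x, y)) \<in> unit_cube \<rightarrow>\<^sub>M unit_square"
  "(\<lambda>(x, y, z). (x, z)) \<in> unit_cube \<rightarrow>\<^sub>M unit_square"
  "(\<lambda>(x, y, z). (y, z)) \<in> unit_cube \<rightarrow>\<^sub>M unit_square"
  "distr unit_cube unit_square (\<lambda>(x, y, z). (x, y)) = unit_square"
  "distr unit_cube unit_square (\<lambda>(x, y, z). (x, z)) = unit_square"
  "distr unit_cube unit_square (\<lambda>(x, y, z). (y, z)) = unit_square"
  unfolding unit_cube_eq unit_square_eq
  by (rule completion_measure_preserving; (rule prob_space.distr_triple_projections[OF prob_space_unit] | measurable))+

lemma prob_space_square: "prob_space unit_square"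
  by (intro prob_spaceI) (simp add: emeasure_restrict_space borel_Times emeasure_lborel_Times)

lemma prob_space_cube: "prob_space unit_cube"
  by (intro prob_spaceI) (simp add: emeasure_restrict_space borel_Times emeasure_lborel_Times)

lemma measure_unit [simp]:
  "measure unit_square ({0..1} \<times> {0..1}) = 1"
  "measure unit_cube ({0..1} \<times> {0..1} \<times> {0..1}) = 1"
  using prob_space.prob_space[OF prob_space_square] prob_space.prob_space[OF prob_space_cube] by simp_all

lemma unit_cube_measurable:
  fixes g :: "real \<Rightarrow> real \<Rightarrow> real"
  assumes "(\<lambda>(x, y). g x y) \<in> borel_measurable unit_square"
  shows "(\<lambda>(x, y, z). g x y) \<in> borel_measurable unit_cube"
    and "(\<lambda>(x, y, z). g x z) \<in> borel_measurable unit_cube"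
    and "(\<lambda>(x, y, z). g y z) \<in> borel_measurable unit_cube"
  using unit_cube_projections(1-3)[THEN measurable_compose, OF assms]
  by (simp_all add: case_prod_unfold)

lemma unit_cube_integral:
  fixes g :: "real \<Rightarrow> real \<Rightarrow> real"
  assumes "(\<lambda>(x, y). g x y) \<in> borel_measurable unit_square"
  shows "(LINT (x, y, z)|unit_cube. g x y) = (LINT (x, y)|unit_square. g x y)"
    and "(LINT (x, y, z)|unit_cube. g x z) = (LINT (x, y)|unit_square. g x y)"
    and "(LINT (x, y, z)|unit_cube. g y z) = (LINT (x, y)|unit_square. g x y)"
  using integral_distr[OF unit_cube_projections(1) assms]
    integral_distr[OF unit_cube_projections(2) assms]
    integral_distr[OF unit_cube_projections(3) assms]
  unfolding unit_cube_projections by (simp_all add: case_prod_unfold)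

lemma integrable_square:
  fixes g :: "real \<Rightarrow> real \<Rightarrow> real"
  assumes "(\<lambda>(x, y). g x y) \<in> borel_measurable unit_square"
    and "\<And>x y. x \<in> {0..1} \<Longrightarrow> y \<in> {0..1} \<Longrightarrow> \<bar>g x y\<bar> \<le> B"
  shows "integrable unit_square (\<lambda>(x, y). g x y)"
  using assms prob_space_square
  by (intro finite_measure.integrable_const_bound[where B = B] AE_I2) (auto simp: prob_space_def)

lemma integrable_cube:
  fixes g :: "real \<Rightarrow> real \<Rightarrow> real \<Rightarrow> real"
  assumes "(\<lambda>(x, y, z). g x y z) \<in> borel_measurable unit_cube"
    and "\<And>x y z. x \<in> {0..1} \<Longrightarrow> y \<in> {0..1} \<Longrightarrow> z \<in> {0..1} \<Longrightarrow> \<bar>g x y z\<bar> \<le> B"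
  shows "integrable unit_cube (\<lambda>(x, y, z). g x y z)"
  using assms prob_space_cube
  by (intro finite_measure.integrable_const_bound[where B = B] AE_I2) (auto simp: prob_space_def)

section \<open>Strong convexity of the entropy\<close>

text \<open>Since \<open>1 / x + 1 / (1 - x) \<ge> 4\<close>, the function
  \<open>entropy_I x - 2 * x\<^sup>2\<close> is convex on the open interval and lies above its
  tangent at \<open>c\<close>. The endpoints \<open>w = 0\<close> and \<open>w = 1\<close> are
  outside that interval; there the claim collapses to \<open>endpoint\<close> at \<open>c\<close>
  and at \<open>1 - c\<close>.\<close>

lemma entropy_I_above_tangent:
  assumes c: "0 < c" "c < 1" and w: "0 \<le> w" "w \<le> 1"
  shows "entropy_I c + (ln c - ln (1 - c)) * (w - c) + 2 * (w - c)\<^sup>2 \<le> entropy_I w"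
proof -
  have endpoint: "ln (1 - x) + 2 * x\<^sup>2 \<le> 0" if "0 < x" "x < 1" for x :: real
  proof -
    have "ln (1 - x) + 2 * x\<^sup>2 \<le> ln (1 - 0) + 2 * 0\<^sup>2"
    proof (rule DERIV_nonpos_imp_nonincreasing[where f = "\<lambda>y. ln (1 - y) + 2 * y\<^sup>2"])
      fix y assume y: "0 \<le> y" "y \<le> x"
      \<comment> \<open>This square encodes \<open>4 * y * (1 - y) \<le> 1\<close>, which is the
        required sign of the derivative.\<close>
      have "(2 * y - 1)\<^sup>2 \<ge> 0" by simp
      then have "4 * y - 1 / (1 - y) \<le> 0"
        using y that by (simp add: field_simps power2_eq_square)
      moreover have "((\<lambda>y. ln (1 - y) + 2 * y\<^sup>2) has_real_derivative (4 * y - 1 / (1 - y))) (at y)"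
        using y that by (auto intro!: derivative_eq_intros)
      ultimately show "\<exists>D. ((\<lambda>y. ln (1 - y) + 2 * y\<^sup>2) has_real_derivative D) (at y) \<and> D \<le> 0"
        by blast
    qed (use that in simp)
    then show ?thesis by simp
  qed
  consider "w = 0" | "w = 1" | "0 < w" "w < 1" using w by linarith
  then show ?thesis
  proof cases
    case 1
    then show ?thesis using endpoint[OF c] by (simp add: entropy_I_def algebra_simps power2_eq_square)
  next
    case 2
    then show ?thesis using endpoint[of "1 - c"] c by (simp add: entropy_I_def algebra_simps power2_eq_square)
  next
    case 3
    let ?f = "\<lambda>x. entropy_I x - 2 * x\<^sup>2"
    let ?f' = "\<lambda>x. ln x - ln (1 - x) - 4 * x"
    have d: "(?f has_real_derivative ?f' x) (at x)" if "x \<in> {0<..<1}" for x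
      unfolding entropy_I_def using that by (auto intro!: derivative_eq_intros)
    have "convex_on {0<..<1} ?f"
    proof (rule f''_ge0_imp_convex)
      show "(?f has_real_derivative ?f' x) (at x)" if "x \<in> {0<..<1}" for x by (rule d[OF that])
      show "(?f' has_real_derivative (1 / x + 1 / (1 - x) - 4)) (at x)" if "x \<in> {0<..<1}" for x
        using that by (auto intro!: derivative_eq_intros)
      show "0 \<le> 1 / x + 1 / (1 - x) - 4" if "x \<in> {0<..<1}" for x :: real
      proof -
        have "0 \<le> (2 * x - 1)\<^sup>2" by simp
        then show ?thesis using that by (simp add: field_simps power2_eq_square)
      qed
    qed auto
    then have "?f w - ?f c \<ge> ?f' c * (w - c)"
      by (rule convex_on_imp_above_tangent) (use c 3 d[of c] in \<open>auto intro: has_field_derivative_at_within\<close>)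
    then show ?thesis by (simp add: algebra_simps power2_eq_square)
  qed
qed

text \<open>The lower bound is the tangent inequality at \<open>1/2\<close>, where the slope
  vanishes.\<close>

lemma entropy_I_bounds:
  assumes "0 \<le> w" "w \<le> 1"
  shows "- ln 2 \<le> entropy_I w" "entropy_I w \<le> 0"
proof -
  have "entropy_I (1/2) = - ln 2" by (simp add: entropy_I_def ln_div)
  moreover have "entropy_I (1/2) + 2 * (w - 1 / 2)\<^sup>2 \<le> entropy_I w"
    using entropy_I_above_tangent[of "1/2" w] assms by simp
  moreover have "0 \<le> (w - 1 / 2)\<^sup>2" by simp
  ultimately show "- ln 2 \<le> entropy_I w" by linarith
  have "w * ln w \<le> 0" "(1 - w) * ln (1 - w) \<le> 0"
    using assms by (cases "w = 0"; cases "w = 1"; simp add: mult_nonneg_nonpos)+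
  then show "entropy_I w \<le> 0" by (simp add: entropy_I_def)
qed

section \<open>Expansion of the induced density around a constant\<close>

text \<open>Let \<open>a\<close>, \<open>b\<close>, \<open>d\<close> be the values of
  \<open>U\<close> on the three edges and multiply out
  \<open>(c + a) * (c + b) * (1 - c - d)\<close>. The linear terms integrate to zero because each
  depends on one edge only and \<open>U\<close> has mean zero.\<close>

lemma t_ind_K12_expansion:
  fixes U :: "real \<Rightarrow> real \<Rightarrow> real"
  assumes meas: "(\<lambda>(x, y). U x y) \<in> borel_measurable unit_square"
    and bound: "\<And>x y. x \<in> {0..1} \<Longrightarrow> y \<in> {0..1} \<Longrightarrow> \<bar>U x y\<bar> \<le> 1"
    and mean: "(LINT (x, y)|unit_square. U x y) = 0"
  shows "integrable unit_cube (\<lambda>(x, y, z). (1 - c) * (U x y * U x z)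
      - c * (U x y * U y z) - c * (U x z * U y z) - U x y * U x z * U y z)" (is ?int)
    and "t_ind_K12 (\<lambda>x y. c + U x y) = c\<^sup>2 * (1 - c)
      + (LINT (x, y, z)|unit_cube. (1 - c) * (U x y * U x z)
          - c * (U x y * U y z) - c * (U x z * U y z) - U x y * U x z * U y z)"
proof -
  interpret prob_space unit_cube by (rule prob_space_cube)
  define a b d where "a = (\<lambda>(x, y, z::real). U x y)" and "b = (\<lambda>(x, y::real, z). U x z)"
    and "d = (\<lambda>(x::real, y, z). U y z)"
  note defs = a_def b_def d_def
  have m [measurable]: "a \<in> borel_measurable unit_cube" "b \<in> borel_measurable unit_cube"
    "d \<in> borel_measurable unit_cube"
    unfolding defs using meas by (rule unit_cube_measurable)+
  have abs: "\<bar>a p\<bar> \<le> 1" "\<bar>b p\<bar> \<le> 1" "\<bar>d p\<bar> \<le> 1" if "p \<in> space unit_cube" for p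
    using that bound by (auto simp: defs)
  have bounded: "\<bar>u * v\<bar> \<le> 1" if "\<bar>u\<bar> \<le> 1" "\<bar>v\<bar> \<le> 1" for u v :: real
    using that by (simp add: abs_mult mult_le_one)
  have int [simp]: "integrable unit_cube a" "integrable unit_cube b" "integrable unit_cube d"
    "integrable unit_cube (\<lambda>p. a p * b p)" "integrable unit_cube (\<lambda>p. a p * d p)"
    "integrable unit_cube (\<lambda>p. b p * d p)" "integrable unit_cube (\<lambda>p. a p * b p * d p)"
    using abs by (auto intro!: integrable_const_bound[where B = 1] AE_I2 bounded)
  have zero: "integral\<^sup>L unit_cube a = 0" "integral\<^sup>L unit_cube b = 0" "integral\<^sup>L unit_cube d = 0"
    using unit_cube_integral[OF meas] mean by (simp_all add: defs)
  let ?R = "\<lambda>p. (1 - c) * (a p * b p) - c * (a p * d p) - c * (b p * d p) - a p * b p * d p"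
  have R: "integrable unit_cube ?R" by simp
  have eq: "(\<lambda>(x, y, z). (1 - c) * (U x y * U x z)
      - c * (U x y * U y z) - c * (U x z * U y z) - U x y * U x z * U y z) = ?R"
    by (auto simp: defs)
  show ?int using R by (simp only: eq)
  have "t_ind_K12 (\<lambda>x y. c + U x y) = (LINT p|unit_cube. (c + a p) * (c + b p) * (1 - (c + d p)))"
    unfolding t_ind_K12_def defs by (intro Bochner_Integration.integral_cong) auto
  also have "\<dots> = (LINT p|unit_cube. c\<^sup>2 * (1 - c) + c * (1 - c) * a p + c * (1 - c) * b p - c\<^sup>2 * d p + ?R p)"
    by (intro Bochner_Integration.integral_cong refl) (simp add: algebra_simps power2_eq_square)
  also have "\<dots> = c\<^sup>2 * (1 - c) + integral\<^sup>L unit_cube ?R"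
    by (subst Bochner_Integration.integral_add[OF _ R]) (simp_all add: zero)
  finally show "t_ind_K12 (\<lambda>x y. c + U x y) = c\<^sup>2 * (1 - c)
      + (LINT (x, y, z)|unit_cube. (1 - c) * (U x y * U x z)
          - c * (U x y * U y z) - c * (U x z * U y z) - U x y * U x z * U y z)"
    by (simp only: eq)
qed

text \<open>AM-GM on each product, with the cubic term first reduced to a quadratic one by
  \<open>\<bar>d\<bar> \<le> 1\<close>. The weights of \<open>a\<^sup>2\<close> and
  \<open>b\<^sup>2\<close> add up as \<open>(1 - c) / 2 + c / 2 + 1 / 2 = 1\<close>, those of
  \<open>d\<^sup>2\<close> as \<open>c / 2 + c / 2\<close>.\<close>

lemma abs_expansion_remainder_le:
  fixes a b c d :: real
  assumes "0 \<le> c" "c \<le> 1" "\<bar>d\<bar> \<le> 1"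
  shows "\<bar>(1 - c) * (a * b) - c * (a * d) - c * (b * d) - a * b * d\<bar> \<le> a\<^sup>2 + b\<^sup>2 + c * d\<^sup>2"
proof -
  have amgm: "\<bar>u * v\<bar> \<le> (u\<^sup>2 + v\<^sup>2) / 2" for u v :: real
    using sum_squares_bound[of "\<bar>u\<bar>" "\<bar>v\<bar>"] by (simp add: abs_mult)
  have "\<bar>(1 - c) * (a * b)\<bar> \<le> (1 - c) * ((a\<^sup>2 + b\<^sup>2) / 2)"
    "\<bar>c * (a * d)\<bar> \<le> c * ((a\<^sup>2 + d\<^sup>2) / 2)" "\<bar>c * (b * d)\<bar> \<le> c * ((b\<^sup>2 + d\<^sup>2) / 2)"
    using assms(1,2) mult_left_mono[OF amgm, of "1 - c"] mult_left_mono[OF amgm, of c]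
    by (simp_all only: abs_mult[of "1 - c"] abs_mult[of c] abs_of_nonneg diff_ge_0_iff_ge)
  moreover have "\<bar>a * b * d\<bar> \<le> (a\<^sup>2 + b\<^sup>2) / 2 * 1"
    unfolding abs_mult[of _ d] using assms amgm by (intro mult_mono) auto
  ultimately have "\<bar>(1 - c) * (a * b) - c * (a * d) - c * (b * d) - a * b * d\<bar>
      \<le> (1 - c) * ((a\<^sup>2 + b\<^sup>2) / 2) + c * ((a\<^sup>2 + d\<^sup>2) / 2) + c * ((b\<^sup>2 + d\<^sup>2) / 2) + (a\<^sup>2 + b\<^sup>2) / 2"
    by linarith
  also have "\<dots> = a\<^sup>2 + b\<^sup>2 + c * d\<^sup>2" by (simp add: field_simps)
  finally show ?thesis .
qed

section \<open>Integrability and boundedness for graphons\<close>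

lemma
  assumes "graphon W"
  shows graphon_measurable: "(\<lambda>(x, y). W x y) \<in> borel_measurable unit_square"
    and graphon_range: "\<And>x y. x \<in> {0..1} \<Longrightarrow> y \<in> {0..1} \<Longrightarrow> 0 \<le> W x y \<and> W x y \<le> 1"
  using assms by (auto simp: graphon_def)

lemma integrable_entropy_I:
  assumes "graphon W"
  shows "integrable unit_square (\<lambda>(x, y). entropy_I (W x y))"
proof (rule integrable_square[where B = "ln 2"])
  have "entropy_I \<in> borel_measurable borel"
    unfolding entropy_I_def[abs_def] by measurable
  from measurable_compose[OF graphon_measurable[OF assms] this]
  show "(\<lambda>(x, y). entropy_I (W x y)) \<in> borel_measurable unit_square"
    by (simp add: case_prod_unfold)
  show "\<bar>entropy_I (W x y)\<bar> \<le> ln 2" if "x \<in> {0..1}" "y \<in> {0..1}" for x y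
    using entropy_I_bounds[of "W x y"] graphon_range[OF assms that] by (simp add: abs_le_iff)
qed

text \<open>Makes both suprema genuine: the density lies between 0 and 1 and the entropy integral is
  at least \<open>- ln 2\<close>. Applied to constant graphons it also bounds the second
  supremum.\<close>

lemma graphon_objective_bounded:
  assumes "graphon W"
  shows "\<beta> * t_ind_K12 W - graphon_I W / 2 \<le> \<bar>\<beta>\<bar> + ln 2 / 2"
proof -
  interpret square: prob_space unit_square by (rule prob_space_square)
  interpret cube: prob_space unit_cube by (rule prob_space_cube)
  have m [measurable]: "(\<lambda>(x, y, z). W x y) \<in> borel_measurable unit_cube"
    "(\<lambda>(x, y, z). W x z) \<in> borel_measurable unit_cube"
    "(\<lambda>(x, y, z). W y z) \<in> borel_measurable unit_cube"
    by (rule unit_cube_measurable[OF graphon_measurable[OF assms]])+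
  have I: "- ln 2 \<le> graphon_I W"
    unfolding graphon_I_def using integrable_entropy_I[OF assms] graphon_range[OF assms]
    by (intro square.integral_ge_const) (auto intro!: AE_I2 entropy_I_bounds)
  have range: "0 \<le> W x y * W x z * (1 - W y z) \<and> W x y * W x z * (1 - W y z) \<le> 1"
    if "x \<in> {0..1}" "y \<in> {0..1}" "z \<in> {0..1}" for x y z
    using graphon_range[OF assms] that by (auto intro!: mult_le_one mult_nonneg_nonneg)
  have "(\<lambda>p. (\<lambda>(x, y, z). W x y) p * (\<lambda>(x, y, z). W x z) p * (1 - (\<lambda>(x, y, z). W y z) p))
      \<in> borel_measurable unit_cube" by measurable
  then have "integrable unit_cube (\<lambda>(x, y, z). W x y * W x z * (1 - W y z))"
    using range by (intro integrable_cube[where B = 1]) (auto simp: case_prod_unfold)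
  then have "0 \<le> t_ind_K12 W" "t_ind_K12 W \<le> 1"
    unfolding t_ind_K12_def using range
    by (auto intro!: cube.integral_ge_const cube.integral_le_const AE_I2)
  then have "\<bar>\<beta> * t_ind_K12 W\<bar> \<le> \<bar>\<beta>\<bar>"
    by (simp add: abs_mult mult_left_le)
  with I show ?thesis by linarith
qed

section \<open>Small parameters: comparison of a graphon with its mean\<close>

text \<open>The witness is the mean of \<open>W\<close>. With \<open>S\<close> the variance, the
  density moves by at most \<open>3 * S\<close> while half the entropy integral grows by at least
  \<open>S\<close>; the two balance exactly at \<open>\<bar>\<beta>\<bar> = 1 / 3\<close>.\<close>

lemma graphon_le_const:
  assumes W: "graphon W" and \<beta>: "\<bar>\<beta>\<bar> \<le> 1 / 3"
  obtains c where "c \<in> {0..1}"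
    "\<beta> * t_ind_K12 W - graphon_I W / 2 \<le> \<beta> * c\<^sup>2 * (1 - c) - entropy_I c / 2"
proof -
  interpret square: prob_space unit_square by (rule prob_space_square)
  interpret cube: prob_space unit_cube by (rule prob_space_cube)
  note W_meas [measurable] = graphon_measurable[OF W] and W_range = graphon_range[OF W]
  define c where "c = (LINT (x, y)|unit_square. W x y)"
  define U where "U = (\<lambda>x y. W x y - c)"
  define S where "S = (LINT (x, y)|unit_square. (U x y)\<^sup>2)"
  have W_int: "integrable unit_square (\<lambda>(x, y). W x y)"
    using W_range by (intro integrable_square[where B = 1] W_meas) auto
  have c: "0 \<le> c" "c \<le> 1"
    unfolding c_def using W_int W_range
    by (auto intro!: square.integral_ge_const square.integral_le_const AE_I2)
  have "(\<lambda>p. (\<lambda>(x, y). W x y) p - c) \<in> borel_measurable unit_square" by measurable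
  then have U_meas [measurable]: "(\<lambda>(x, y). U x y) \<in> borel_measurable unit_square"
    by (simp add: U_def case_prod_unfold)
  have U_bound: "\<bar>U x y\<bar> \<le> 1" if "x \<in> {0..1}" "y \<in> {0..1}" for x y
    using W_range[OF that] c by (auto simp: U_def abs_le_iff)
  have U_mean: "(LINT (x, y)|unit_square. U x y) = 0"
    using W_int by (simp add: U_def case_prod_unfold c_def)
  have "(\<lambda>p. ((\<lambda>(x, y). U x y) p)\<^sup>2) \<in> borel_measurable unit_square" by measurable
  then have U2_meas: "(\<lambda>(x, y). (U x y)\<^sup>2) \<in> borel_measurable unit_square"
    by (simp add: case_prod_unfold)
  have U2_bound: "\<bar>(U x y)\<^sup>2\<bar> \<le> 1" if "x \<in> {0..1}" "y \<in> {0..1}" for x y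
    using U_bound[OF that] by (simp add: abs_square_le_1)
  have U2_int: "integrable unit_square (\<lambda>(x, y). (U x y)\<^sup>2)"
    by (rule integrable_square[OF U2_meas U2_bound])
  have S0: "0 \<le> S" unfolding S_def by (intro integral_nonneg_AE AE_I2) auto

  have T: "\<bar>t_ind_K12 W - c\<^sup>2 * (1 - c)\<bar> \<le> 3 * S"
  proof -
    note T = t_ind_K12_expansion[OF U_meas U_bound U_mean, of c]
    note U2_cube = unit_cube_measurable[OF U2_meas]
    have int: "integrable unit_cube (\<lambda>(x, y, z). (U x y)\<^sup>2)"
      "integrable unit_cube (\<lambda>(x, y, z). (U x z)\<^sup>2)"
      "integrable unit_cube (\<lambda>(x, y, z). (U y z)\<^sup>2)"
      using U2_bound by (auto intro!: integrable_cube[where B = 1] U2_cube)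
    have "\<bar>t_ind_K12 W - c\<^sup>2 * (1 - c)\<bar> = \<bar>LINT (x, y, z)|unit_cube. (1 - c) * (U x y * U x z)
          - c * (U x y * U y z) - c * (U x z * U y z) - U x y * U x z * U y z\<bar>"
      using T(2) by (simp add: U_def)
    also have "\<dots> \<le> (LINT p|unit_cube. (\<lambda>(x, y, z). (U x y)\<^sup>2) p + (\<lambda>(x, y, z). (U x z)\<^sup>2) p
        + c * (\<lambda>(x, y, z). (U y z)\<^sup>2) p)"
      using U_bound c
      by (intro order_trans[OF integral_abs_bound] integral_mono integrable_abs T(1)
            Bochner_Integration.integrable_add integrable_mult_right int)
         (auto intro!: abs_expansion_remainder_le)
    also have "\<dots> = S + S + c * S"
      using int unit_cube_integral[OF U2_meas] by (simp add: S_def)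
    also have "\<dots> \<le> 3 * S"
      using S0 c mult_right_mono[of c 1 S] by simp
    finally show ?thesis .
  qed

  have I: "entropy_I c + 2 * S \<le> graphon_I W"
  proof (cases "0 < c \<and> c < 1")
    case True
    \<comment> \<open>Integrating the tangent inequality: the linear term disappears because
      \<open>U\<close> has mean zero.\<close>
    have "(LINT p|unit_square. entropy_I c + (ln c - ln (1 - c)) * (\<lambda>(x, y). U x y) p
        + 2 * (\<lambda>(x, y). (U x y)\<^sup>2) p) \<le> graphon_I W"
      unfolding graphon_I_def using True W_range
      by (intro integral_mono integrable_entropy_I W Bochner_Integration.integrable_add
            integrable_mult_right U2_int integrable_square[OF U_meas U_bound])
         (auto simp: U_def intro!: entropy_I_above_tangent)
    moreover have "(LINT p|unit_square. entropy_I c + (ln c - ln (1 - c)) * (\<lambda>(x, y). U x y) p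
        + 2 * (\<lambda>(x, y). (U x y)\<^sup>2) p) = entropy_I c + 2 * S"
      using U2_int integrable_square[OF U_meas U_bound] U_mean by (simp add: S_def)
    ultimately show ?thesis by simp
  next
    case False
    then have c01: "c = 0 \<or> c = 1" using c by linarith
    \<comment> \<open>At mean 0 or 1 the entropy has no finite tangent, but \<open>W\<close> is then
      almost everywhere equal to \<open>c\<close>: pointwise \<open>W\<^sup>2 \<le> W\<close>, so
      \<open>S\<close> is at most
      \<open>(1 - 2 * c) * c + c\<^sup>2 = c - c\<^sup>2 = 0\<close>.\<close>
    have "S \<le> (LINT p|unit_square. (1 - 2 * c) * (\<lambda>(x, y). W x y) p + c\<^sup>2)"
      unfolding S_def
    proof (intro integral_mono U2_int)
      fix p assume "p \<in> space unit_square"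
      then have "(W (fst p) (snd p))\<^sup>2 \<le> W (fst p) (snd p)"
        using W_range by (auto simp: power2_eq_square mult_left_le)
      then show "(\<lambda>(x, y). (U x y)\<^sup>2) p \<le> (1 - 2 * c) * (\<lambda>(x, y). W x y) p + c\<^sup>2"
        by (simp add: U_def case_prod_unfold power2_eq_square algebra_simps)
    qed (use W_int in simp)
    also have "\<dots> = 0"
      using W_int c01 by (auto simp: c_def[symmetric])
    finally have "S = 0" using S0 by simp
    then have "AE p in unit_square. (\<lambda>(x, y). (U x y)\<^sup>2) p = 0"
      using integral_nonneg_eq_0_iff_AE[OF U2_int] by (simp add: S_def case_prod_unfold)
    then have "AE p in unit_square. (\<lambda>(x, y). entropy_I (W x y)) p = 0"
      by eventually_elim (use c01 in \<open>auto simp: U_def entropy_I_def\<close>)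
    then have "graphon_I W = 0"
      unfolding graphon_I_def using integral_eq_zero_AE by blast
    then show ?thesis using \<open>S = 0\<close> c01 by (auto simp: entropy_I_def)
  qed

  have "\<beta> * (t_ind_K12 W - c\<^sup>2 * (1 - c)) \<le> \<bar>\<beta>\<bar> * \<bar>t_ind_K12 W - c\<^sup>2 * (1 - c)\<bar>"
    by (metis abs_ge_self abs_mult)
  also have "\<dots> \<le> 1 / 3 * (3 * S)" using T \<beta> by (intro mult_mono) auto
  finally have "\<beta> * t_ind_K12 W - graphon_I W / 2 \<le> \<beta> * c\<^sup>2 * (1 - c) - entropy_I c / 2"
    using I by (simp add: algebra_simps)
  with c show thesis by (intro that[of c]) auto
qed

section \<open>Constant graphons and the two suprema\<close>

lemma
  assumes "c \<in> {0..1}"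
  shows graphon_const: "graphon (\<lambda>x y. c)"
    and t_ind_K12_const: "t_ind_K12 (\<lambda>x y. c) = c\<^sup>2 * (1 - c)"
    and graphon_I_const: "graphon_I (\<lambda>x y. c) = entropy_I c"
  using assms by (simp_all add: graphon_def t_ind_K12_def graphon_I_def case_prod_unfold power2_eq_square)

lemma psi_wedge_upper: "graphon W \<Longrightarrow> \<beta> * t_ind_K12 W - graphon_I W / 2 \<le> psi_wedge \<beta>"
  unfolding psi_wedge_def using graphon_objective_bounded[of _ \<beta>]
  by (intro cSUP_upper) (auto intro!: bdd_aboveI2)

lemma psi_wedge_const_le: "psi_wedge_const \<beta> \<le> psi_wedge \<beta>"
  unfolding psi_wedge_const_def
proof (rule cSUP_least)
  fix c :: real assume "c \<in> {0..1}"
  then show "\<beta> * c\<^sup>2 * (1 - c) - entropy_I c / 2 \<le> psi_wedge \<beta>"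
    using psi_wedge_upper[OF graphon_const, of c \<beta>]
    by (simp add: t_ind_K12_const graphon_I_const mult.assoc)
qed simp

lemma psi_wedge_const_upper:
  assumes "c \<in> {0..1}"
  shows "\<beta> * c\<^sup>2 * (1 - c) - entropy_I c / 2 \<le> psi_wedge_const \<beta>"
  unfolding psi_wedge_const_def
proof (rule cSUP_upper[OF assms])
  show "bdd_above ((\<lambda>c. \<beta> * c\<^sup>2 * (1 - c) - entropy_I c / 2) ` {0..1})"
    using graphon_objective_bounded[OF graphon_const, of _ \<beta>]
    by (intro bdd_aboveI2[where M = "\<bar>\<beta>\<bar> + ln 2 / 2"])
       (simp add: t_ind_K12_const graphon_I_const mult.assoc)
qed

lemma psi_wedge_eq_const:
  assumes "\<bar>\<beta>\<bar> \<le> 1 / 3"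
  shows "psi_wedge \<beta> = psi_wedge_const \<beta>"
proof (rule antisym[OF _ psi_wedge_const_le])
  show "psi_wedge \<beta> \<le> psi_wedge_const \<beta>"
    unfolding psi_wedge_def
  proof (rule cSUP_least)
    show "{W. graphon W} \<noteq> {}" using graphon_const[of 0] by auto
    fix W assume "W \<in> {W. graphon W}"
    then obtain c where "c \<in> {0..1}"
      "\<beta> * t_ind_K12 W - graphon_I W / 2 \<le> \<beta> * c\<^sup>2 * (1 - c) - entropy_I c / 2"
      using graphon_le_const[OF _ assms] by blast
    then show "\<beta> * t_ind_K12 W - graphon_I W / 2 \<le> psi_wedge_const \<beta>"
      using psi_wedge_const_upper order_trans by blast
  qed
qed

section \<open>Large parameters: numerical bound for constants\<close>

text \<open>\<open>5/3\<close> and \<open>8/3\<close> come from the tangent of the entropy at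
  \<open>5/8\<close>; the other three determine the entropies of the block values
  \<open>1/15\<close> and \<open>224/225\<close>.\<close>

lemma log_bounds:
  shows "0.5108 \<le> ln (5 / 3 :: real)" "ln (8 / 3 :: real) \<le> 0.98084" "2.7068 \<le> ln (15 :: real)"
    and "0.06899 \<le> ln (15 / 14 :: real)" "0.004454 \<le> ln (225 / 224 :: real)"
proof -
  show *: "0.5108 \<le> ln (5 / 3 :: real)"
    using ln_approx_bounds[of "5/3" 4] by (simp add: eval_nat_numeral)
  show "ln (8 / 3 :: real) \<le> 0.98084"
    using ln_approx_bounds[of "8/3" 7] by (simp add: eval_nat_numeral)
  have "1.098 \<le> ln (3 :: real)"
    using ln_approx_bounds[of "3" 5] by (simp add: eval_nat_numeral)
  \<comment> \<open>The series converges slowly at 15, so the argument is factored into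
    \<open>5/3\<close> and two factors 3.\<close>
  moreover have "ln (15 :: real) = ln (5 / 3) + 2 * ln 3"
    using ln_mult[of "5 / 3" "3 * 3 :: real"] ln_mult[of "3 :: real" 3] by simp
  ultimately show "2.7068 \<le> ln (15 :: real)" using * by simp
  show "0.06899 \<le> ln (15 / 14 :: real)"
    using ln_approx_bounds[of "15/14" 2] by (simp add: eval_nat_numeral)
  show "0.004454 \<le> ln (225 / 224 :: real)"
    using ln_approx_bounds[of "225/224" 1] by (simp add: eval_nat_numeral)
qed

text \<open>For each \<open>c\<close> the objective is affine in \<open>\<beta>\<close> with slope
  \<open>c\<^sup>2 * (1 - c) \<le> 4 / 27\<close>, so only \<open>\<beta> = 3.054\<close> needs a
  numerical estimate.\<close>

lemma psi_wedge_const_le_linear: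
  assumes "\<beta> \<ge> 3.054"
  shows "psi_wedge_const \<beta> \<le> 0.7782 + (\<beta> - 3.054) * (4 / 27)"
  unfolding psi_wedge_const_def
proof (rule cSUP_least)
  fix c :: real assume c: "c \<in> {0..1}"
  \<comment> \<open>The double root sits at the maximiser \<open>2/3\<close> of
    \<open>c\<^sup>2 * (1 - c)\<close>, which certifies the maximum \<open>4/27\<close>.\<close>
  have "(c - 2 / 3)\<^sup>2 * (c + 1 / 3) = 4 / 27 - c\<^sup>2 * (1 - c)"
    by (simp add: power2_eq_square field_simps)
  moreover have "0 \<le> (c - 2 / 3)\<^sup>2 * (c + 1 / 3)" using c by simp
  ultimately have "c\<^sup>2 * (1 - c) \<le> 4 / 27" by linarith
  then have slope: "(\<beta> - 3.054) * (c\<^sup>2 * (1 - c)) \<le> (\<beta> - 3.054) * (4 / 27)"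
    using assms by (intro mult_left_mono) auto
  have ln58: "ln (5 / 8 :: real) = ln (5 / 3) - ln (8 / 3)" "ln (3 / 8 :: real) = - ln (8 / 3)"
    by (simp_all add: ln_div)
  \<comment> \<open>The tangent of \<open>I\<close> at \<open>5/8\<close>, near the optimal constant, leaves a cubic to maximise.\<close>
  have "entropy_I c \<ge> entropy_I (5 / 8) + (ln (5 / 8) - ln (3 / 8)) * (c - 5 / 8) + 2 * (c - 5 / 8)\<^sup>2"
    using entropy_I_above_tangent[of "5 / 8" c] c by simp
  also have "entropy_I (5 / 8) = 5 / 8 * ln (5 / 8) + 3 / 8 * ln (3 / 8)"
    by (simp add: entropy_I_def)
  finally have "c * ln (5 / 3) - ln (8 / 3) + 2 * (c - 5 / 8)\<^sup>2 \<le> entropy_I c"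
    unfolding ln58 by (simp add: algebra_simps)
  then have "c * ln (5 / 3) - ln (8 / 3) \<le> entropy_I c"
    using zero_le_power2[of "c - 5 / 8"] by linarith
  moreover have "c * 0.5108 \<le> c * ln (5 / 3)"
    using c log_bounds(1) by (intro mult_left_mono) auto
  ultimately have ent: "c * 0.5108 - 0.98084 \<le> entropy_I c"
    using log_bounds(2) by linarith
  \<comment> \<open>\<open>0.62184\<close> is close to the maximiser of \<open>3.054 c\<^sup>2 (1 - c) - 0.2554 c\<close>.\<close>
  have "(c - 0.62184)\<^sup>2 * (c + 0.24368)
      = (0.62184\<^sup>2 - 2 * 0.62184 * 0.24368) * c + 0.62184\<^sup>2 * 0.24368 - c\<^sup>2 * (1 - c)"
    by (simp add: power2_eq_square field_simps)
  moreover have "0 \<le> (c - 0.62184)\<^sup>2 * (c + 0.24368)" using c by simp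
  \<comment> \<open>The shift \<open>0.24368\<close> is \<open>2 * 0.62184 - 1\<close>, chosen to
    match the quadratic coefficient; the right-hand side is the tangent line of
    \<open>c\<^sup>2 * (1 - c)\<close> at \<open>0.62184\<close>.\<close>
  ultimately have "c\<^sup>2 * (1 - c) \<le> (0.62184\<^sup>2 - 2 * 0.62184 * 0.24368) * c + 0.62184\<^sup>2 * 0.24368"
    by linarith
  \<comment> \<open>Two affine functions of \<open>c \<ge> 0\<close> compared coefficient by
    coefficient; \<open>0.49042\<close> and \<open>0.2554\<close> are half of \<open>0.98084\<close>
    and \<open>0.5108\<close>.\<close>
  also have "\<dots> \<le> (0.7782 - 0.49042 + c * 0.2554) / 3.054"
    using c by (simp add: power2_eq_square)
  finally have "3.054 * (c\<^sup>2 * (1 - c)) \<le> 0.7782 - 0.49042 + c * 0.2554"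
    by simp
  moreover have "\<beta> * c\<^sup>2 * (1 - c) = (\<beta> - 3.054) * (c\<^sup>2 * (1 - c)) + 3.054 * (c\<^sup>2 * (1 - c))"
    by (simp add: algebra_simps)
  ultimately show "\<beta> * c\<^sup>2 * (1 - c) - entropy_I c / 2 \<le> 0.7782 + (\<beta> - 3.054) * (4 / 27)"
    using slope ent by linarith
qed simp

section \<open>Large parameters: the two-block graphon\<close>

text \<open>A Rademacher function on the unit interval: mean zero and square 1. The product of its
  values at \<open>x\<close> and \<open>y\<close> is 1 inside the two diagonal blocks and -1 across
  them.\<close>

definition half_sign :: "real \<Rightarrow> real" where
  "half_sign x = 1 - 2 * indicator {1/2..} x"

lemma half_sign_square [simp]:
  "half_sign x * half_sign x = 1" "half_sign x * (half_sign x * y) = y"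
  by (auto simp: half_sign_def indicator_def)

lemma half_sign_cases: "half_sign x = 1 \<or> half_sign x = -1"
  by (auto simp: half_sign_def indicator_def)

lemma half_sign_measurable [measurable]: "half_sign \<in> borel_measurable borel"
  unfolding half_sign_def[abs_def] by measurable

text \<open>By Fubini on the uncompleted product the inner integral already vanishes,
  \<open>half_sign\<close> having mean zero; the result then passes to the completion.\<close>

lemma half_sign_product:
  "(\<lambda>(x, y). half_sign x * half_sign y) \<in> borel_measurable unit_square"
  "(LINT (x, y)|unit_square. half_sign x * half_sign y) = 0"
proof -
  let ?P = "restrict_space lborel {0..1::real}"
  interpret P: prob_space ?P by (rule prob_space_unit)
  interpret PP: pair_prob_space ?P ?P ..
  have h [measurable]: "half_sign \<in> borel_measurable ?P"
    by (intro measurable_restrict_space1) simp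
  have m: "(\<lambda>(x, y). half_sign x * half_sign y) \<in> borel_measurable (?P \<Otimes>\<^sub>M ?P)"
    by measurable
  show "(\<lambda>(x, y). half_sign x * half_sign y) \<in> borel_measurable unit_square"
    unfolding unit_square_eq using m by (rule measurable_completion)
  have int: "integrable (?P \<Otimes>\<^sub>M ?P) (\<lambda>(x, y). half_sign x * half_sign y)"
  proof (rule PP.integrable_const_bound[where B = 1])
    have "\<bar>half_sign x * half_sign y\<bar> \<le> 1" for x y
      using half_sign_cases[of x] half_sign_cases[of y] by auto
    then show "AE p in ?P \<Otimes>\<^sub>M ?P. norm (case p of (x, y) \<Rightarrow> half_sign x * half_sign y) \<le> 1"
      by (auto intro!: AE_I2)
  qed (rule m)
  have "measure ?P {1/2..1} = 1 / 2"
    by (subst measure_restrict_space) auto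
  moreover have "{1/2..} \<inter> {0..1} = {1/2..1::real}" by auto
  moreover have "{1/2..1} \<in> sets ?P" by (auto simp: sets_restrict_space_iff)
  moreover have "integral\<^sup>L ?P half_sign = (LINT x|?P. 1 - 2 * indicator {1/2..1} x)"
    by (intro Bochner_Integration.integral_cong) (auto simp: half_sign_def indicator_def)
  ultimately have "integral\<^sup>L ?P half_sign = 0"
    using P.prob_space by (simp add: P.emeasure_eq_measure)
  then have "integral\<^sup>L (?P \<Otimes>\<^sub>M ?P) (\<lambda>(x, y). half_sign x * half_sign y) = 0"
    using PP.integral_fst'[OF int] by simp
  then show "(LINT (x, y)|unit_square. half_sign x * half_sign y) = 0"
    unfolding unit_square_eq using integral_completion[OF m] by simp
qed

text \<open>Each vertex sign occurs twice around the triangle, so the product of \<open>U\<close> on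
  two edges is \<open>- e\<close> times its value on the third, with mean zero, and the product on
  all three is \<open>- e ^ 3\<close>. Only the cubic term of the expansion survives, and it enters
  with a minus sign.\<close>

lemma two_block:
  fixes m e :: real
  assumes "0 \<le> m - e" "m + e \<le> 1" "0 \<le> e"
  defines "W \<equiv> \<lambda>x y. m - e * (half_sign x * half_sign y)"
  shows "graphon W"
    and "t_ind_K12 W = m\<^sup>2 * (1 - m) + e ^ 3"
    and "graphon_I W = (entropy_I (m - e) + entropy_I (m + e)) / 2"
proof -
  interpret square: prob_space unit_square by (rule prob_space_square)
  interpret cube: prob_space unit_cube by (rule prob_space_cube)
  define U where "U = (\<lambda>x y. - e * (half_sign x * half_sign y))"
  note prod [measurable] = half_sign_product(1)
  have int: "integrable unit_square (\<lambda>(x, y). half_sign x * half_sign y)"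
  proof (rule integrable_square[OF prod])
    show "\<bar>half_sign x * half_sign y\<bar> \<le> 1" for x y
      using half_sign_cases[of x] half_sign_cases[of y] by auto
  qed
  have "(\<lambda>p. - e * (\<lambda>(x, y). half_sign x * half_sign y) p) \<in> borel_measurable unit_square"
    by measurable
  then have U_meas: "(\<lambda>(x, y). U x y) \<in> borel_measurable unit_square"
    by (simp add: U_def case_prod_unfold)
  then have "(\<lambda>p. m + (\<lambda>(x, y). U x y) p) \<in> borel_measurable unit_square"
    by measurable
  then have W_meas: "(\<lambda>(x, y). W x y) \<in> borel_measurable unit_square"
    by (simp add: W_def U_def case_prod_unfold)
  have W_cases: "half_sign x * half_sign y = 1 \<and> W x y = m - e
      \<or> half_sign x * half_sign y = -1 \<and> W x y = m + e" for x y
    using half_sign_cases[of x] half_sign_cases[of y] by (auto simp: W_def)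
  have "0 \<le> W x y \<and> W x y \<le> 1" for x y
    using W_cases[of x y] assms(1-3) by auto
  moreover have "W x y = W y x" for x y
    by (simp add: W_def mult.commute)
  ultimately show "graphon W"
    using W_meas unfolding graphon_def atLeastAtMost_iff by blast
  have U_bound: "\<bar>U x y\<bar> \<le> 1" for x y
    using half_sign_cases[of x] half_sign_cases[of y] assms(1-3) by (auto simp: U_def)
  have U_int: "(LINT (x, y)|unit_square. U x y) = 0"
    using int half_sign_product(2) by (simp add: U_def case_prod_unfold)

  define a b d where "a = (\<lambda>(x, y, z::real). U x y)" and "b = (\<lambda>(x, y::real, z). U x z)"
    and "d = (\<lambda>(x::real, y, z). U y z)"
  note defs = a_def b_def d_def
  have int3: "integrable unit_cube a" "integrable unit_cube b" "integrable unit_cube d"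
    unfolding defs by (auto intro!: integrable_cube[where B = 1] unit_cube_measurable[OF U_meas] U_bound)
  have zero: "integral\<^sup>L unit_cube a = 0" "integral\<^sup>L unit_cube b = 0" "integral\<^sup>L unit_cube d = 0"
    unfolding defs using unit_cube_integral[OF U_meas] U_int by simp_all
  have "t_ind_K12 W = m\<^sup>2 * (1 - m) + (LINT (x, y, z)|unit_cube. (1 - m) * (U x y * U x z)
          - m * (U x y * U y z) - m * (U x z * U y z) - U x y * U x z * U y z)"
    using t_ind_K12_expansion(2)[OF U_meas U_bound U_int, of m] by (simp add: W_def U_def)
  also have "(LINT (x, y, z)|unit_cube. (1 - m) * (U x y * U x z)
          - m * (U x y * U y z) - m * (U x z * U y z) - U x y * U x z * U y z)
      = (LINT p|unit_cube. - ((1 - m) * e) * d p + m * e * b p + m * e * a p + e ^ 3)"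
    by (intro Bochner_Integration.integral_cong)
       (auto simp: defs U_def power3_eq_cube mult_ac)
  also have "\<dots> = e ^ 3"
    using int3 by (simp add: zero)
  finally show "t_ind_K12 W = m\<^sup>2 * (1 - m) + e ^ 3" .

  \<comment> \<open>\<open>W\<close> takes only two values, so its entropy is an affine function of
    the sign product, which integrates to zero.\<close>
  have "graphon_I W = (LINT p|unit_square. (entropy_I (m - e) + entropy_I (m + e)) / 2
      + (entropy_I (m - e) - entropy_I (m + e)) / 2 * (\<lambda>(x, y). half_sign x * half_sign y) p)"
    unfolding graphon_I_def
  proof (intro Bochner_Integration.integral_cong refl)
    fix p :: "real \<times> real"
    show "(case p of (x, y) \<Rightarrow> entropy_I (W x y)) = (entropy_I (m - e) + entropy_I (m + e)) / 2
      + (entropy_I (m - e) - entropy_I (m + e)) / 2 * (case p of (x, y) \<Rightarrow> half_sign x * half_sign y)"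
      using W_cases[of "fst p" "snd p"]
      by (elim disjE conjE) (simp_all only: case_prod_unfold, simp_all add: field_simps)
  qed
  also have "\<dots> = (entropy_I (m - e) + entropy_I (m + e)) / 2"
    using int half_sign_product(2) by simp
  finally show "graphon_I W = (entropy_I (m - e) + entropy_I (m + e)) / 2" .
qed

lemma psi_wedge_gt_const:
  assumes "\<beta> \<ge> 3.054"
  shows "psi_wedge_const \<beta> < psi_wedge \<beta>"
proof -
  \<comment> \<open>Midpoint and half-difference of \<open>1/15\<close> and \<open>224/225\<close>.
    As \<open>1 - 224/225\<close> is the square of \<open>1/15\<close>, \<open>ln 15\<close> serves
    for both entropies.\<close>
  define m e :: real where "m = 239 / 450" and "e = 209 / 450"
  define W where "W = (\<lambda>x y. m - e * (half_sign x * half_sign y))"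
  have W: "graphon W" "t_ind_K12 W = m\<^sup>2 * (1 - m) + e ^ 3"
    "graphon_I W = (entropy_I (m - e) + entropy_I (m + e)) / 2"
    unfolding W_def by (rule two_block; simp add: m_def e_def)+
  have "entropy_I (m - e) = - ln 15 / 15 - 14 / 15 * ln (15 / 14)"
    by (simp add: m_def e_def entropy_I_def ln_div field_simps)
  moreover have "entropy_I (m + e) = - (224 / 225) * ln (225 / 224) - 2 / 225 * ln 15"
  proof -
    have "ln (224 / 225 :: real) = - ln (225 / 224)" by (simp add: ln_div)
    moreover have "ln (1 / 225 :: real) = - (2 * ln 15)"
      using ln_realpow[of "15 :: real" 2] by (simp add: ln_div)
    ultimately show ?thesis by (simp add: m_def e_def entropy_I_def)
  qed
  \<comment> \<open>Every logarithm carries a negative coefficient, so lower bounds for the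
    logarithms suffice.\<close>
  ultimately have "graphon_I W \<le> - (2.7068 / 15 + 14 / 15 * 0.06899 + 224 / 225 * 0.004454 + 2 / 225 * 2.7068) / 2"
    unfolding W(3) using log_bounds(3-5) by simp
  then have "0.7782 < 3.054 * t_ind_K12 W - graphon_I W / 2"
    unfolding W(2) by (simp add: m_def e_def eval_nat_numeral)
  moreover have "4 / 27 \<le> t_ind_K12 W"
    unfolding W(2) by (simp add: m_def e_def eval_nat_numeral)
  then have "(\<beta> - 3.054) * (4 / 27) \<le> (\<beta> - 3.054) * t_ind_K12 W"
    using assms by (intro mult_left_mono) auto
  ultimately have "0.7782 + (\<beta> - 3.054) * (4 / 27) < \<beta> * t_ind_K12 W - graphon_I W / 2"
    by (simp add: algebra_simps)
  then show ?thesis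
    using psi_wedge_const_le_linear[OF assms] psi_wedge_upper[OF W(1), of \<beta>] by linarith
qed

theorem proposition3p36:
  "(\<forall>\<beta>\<^sub>2::real. \<bar>\<beta>\<^sub>2\<bar> < 1 / 3 \<longrightarrow> psi_wedge \<beta>\<^sub>2 = psi_wedge_const \<beta>\<^sub>2) \<and>
   (\<forall>\<beta>\<^sub>2::real. \<beta>\<^sub>2 \<ge> 3.054 \<longrightarrow> psi_wedge \<beta>\<^sub>2 > psi_wedge_const \<beta>\<^sub>2)"
  using psi_wedge_eq_const psi_wedge_gt_const by simp

end
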